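(* Let $1<p<\infty$, let $a=\{a_n\}_{n\ge 0}$ be a sequence of complex numbers, and let $T_a$ be the Walsh multiplier with symbol $a$, properly defined as a bounded operator in $L^p[0,1]$. Then for each $n\in\mathbb{N}_0$ the number $a_n$ belongs to the point spectrum of $T_a$, and $W_n$ is an eigenfunction: $T_aW_n=a_nW_n$.
   Context: All function spaces consist of complex-valued functions on $[0,1]$ with Lebesgue measure. For $k\in\mathbb{N}_0=\{0,1,2,\dots\}$ the Rademacher functions are $r_k(x)=\operatorname{sign}(\sin(2^{k+1}\pi x))$, $x\in[0,1)$. If $n=\sum_{k=0}^m b_k2^k$ with $b_k\in\{0,1\}$ is the dyadic expansion of $n\in\mathbb{N}_0$, the Walsh(-Paley) function is $W_n(x)=\prod_{k=0}^m r_k(x)^{b_k}$ (with $W_0=1$). The Walsh functions take values $\pm1$ a.e. and form an orthonormal system in $L^2[0,1]$. For $f\in L^1[0,1]$ the Walsh-Fourier coefficients are $\hat f(n)=\int_0^1 f(x)W_n(x)\,dx$, $n\in\mathbb{N}_0$. The Walsh multiplier operator with symbol $a=\{a_n\}_{n\ge0}$ is given by $T_af=\sum_{n=0}^\infty a_n\hat f(n)W_n$; it is assumed that this formula defines a bounded linear operator from $L^p[0,1]$ to $L^p[0,1]$. The point spectrum is the set of eigenvalues. *)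

theory Defs
  imports "HOL-Analysis.Analysis"
begin

abbreviation unit_leb :: "real measure" where
  "unit_leb \<equiv> lebesgue_on {0..1}"

definition ae_rel :: "(real \<Rightarrow> complex) \<Rightarrow> (real \<Rightarrow> complex) \<Rightarrow> bool" where
  "ae_rel f g \<longleftrightarrow> f \<in> borel_measurable unit_leb \<and> g \<in> borel_measurable unit_leb \<and>
     (AE x in unit_leb. f x = g x)"

lemma part_equivp_ae_rel: "part_equivp ae_rel"
proof (rule part_equivpI)
  show "\<exists>f. ae_rel f f"
    by (rule exI[of _ "\<lambda>x. 0"]) (simp add: ae_rel_def)
  show "symp ae_rel"
    by (rule sympI) (auto simp: ae_rel_def elim: eventually_mono)
  show "transp ae_rel"
  proof (rule transpI)
    fix f g h
    assume "ae_rel f g" and "ae_rel g h"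
    then show "ae_rel f h"
      unfolding ae_rel_def by (auto elim: eventually_elim2)
  qed
qed

text \<open>Measurable functions \<open>[0,1] \<rightarrow> \<complex>\<close> modulo equality almost everywhere. Every space
  \<open>L\<^sup>p[0,1]\<close> is a subset of this one type, since a type cannot depend on the number \<open>p\<close>.\<close>

quotient_type L0 = "real \<Rightarrow> complex" / partial: ae_rel
  by (rule part_equivp_ae_rel)

instantiation L0 :: ab_group_add
begin

lift_definition zero_L0 :: L0 is "\<lambda>x. 0"
  by (simp add: ae_rel_def)

lift_definition plus_L0 :: "L0 \<Rightarrow> L0 \<Rightarrow> L0" is "\<lambda>f g x. f x + g x"
  unfolding ae_rel_def by (auto elim: eventually_elim2)

lift_definition uminus_L0 :: "L0 \<Rightarrow> L0" is "\<lambda>f x. - f x"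
  unfolding ae_rel_def by (auto elim: eventually_mono)

lift_definition minus_L0 :: "L0 \<Rightarrow> L0 \<Rightarrow> L0" is "\<lambda>f g x. f x - g x"
  unfolding ae_rel_def by (auto elim: eventually_elim2)

instance
  by (standard; transfer; auto simp: ae_rel_def algebra_simps)

end

lift_definition cscale :: "complex \<Rightarrow> L0 \<Rightarrow> L0" (infixr "*\<^sub>c" 75) is "\<lambda>c f x. c * f x"
  unfolding ae_rel_def by (auto elim: eventually_mono)

lemma vector_space_cscale: "vector_space (*\<^sub>c)"
  by (standard; transfer; auto simp: ae_rel_def algebra_simps)

lift_definition Lp_integrable :: "real \<Rightarrow> L0 \<Rightarrow> bool"
  is "\<lambda>p f. integrable unit_leb (\<lambda>x. norm (f x) powr p)"
  unfolding ae_rel_def by (intro integrable_cong_AE) (auto elim: eventually_mono)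

definition Lp :: "real \<Rightarrow> L0 set" where
  "Lp p = {f. Lp_integrable p f}"

lift_definition Lp_norm :: "real \<Rightarrow> L0 \<Rightarrow> real"
  is "\<lambda>p f. (LINT x|unit_leb. norm (f x) powr p) powr (1 / p)"
  unfolding ae_rel_def
  by (intro arg_cong[where f = "\<lambda>t. t powr _"] integral_cong_AE) (auto elim: eventually_mono)

definition rademacher :: "nat \<Rightarrow> real \<Rightarrow> real" where
  "rademacher k x = sgn (sin (2 ^ (k + 1) * pi * x))"

text \<open>The factors of \<open>W\<^sub>n\<close> are the \<open>r\<^sub>k\<close> for which the \<open>k\<close>-th binary digit of \<open>n\<close> is \<open>1\<close>.\<close>

definition walsh_fun :: "nat \<Rightarrow> real \<Rightarrow> real" where
  "walsh_fun n x = (\<Prod>k | bit n k. rademacher k x)"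

lemma measurable_walsh_fun [measurable]: "walsh_fun n \<in> borel_measurable unit_leb"
proof -
  have "walsh_fun n \<in> borel_measurable borel"
    unfolding walsh_fun_def rademacher_def by measurable
  then show ?thesis
    by (intro measurable_restrict_space1 measurable_completion) simp
qed

lift_definition walsh :: "nat \<Rightarrow> L0" is "\<lambda>n x. complex_of_real (walsh_fun n x)"
  by (simp add: ae_rel_def)

lift_definition walsh_coeff :: "L0 \<Rightarrow> nat \<Rightarrow> complex"
  is "\<lambda>f n. LINT x|unit_leb. f x * complex_of_real (walsh_fun n x)"
  unfolding ae_rel_def by (intro ext integral_cong_AE) (auto elim: eventually_mono)

text \<open>The series \<open>\<Sum>n. a\<^sub>n c\<^sub>n W\<^sub>n\<close>, with \<open>c\<^sub>n\<close> the Walsh-Fourier coefficients of \<open>f\<close>,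
  is understood as the limit of its partial sums in the norm of \<open>L\<^sup>p[0,1]\<close>.\<close>

definition walsh_multiplier_sums ::
    "real \<Rightarrow> (nat \<Rightarrow> complex) \<Rightarrow> L0 \<Rightarrow> L0 \<Rightarrow> bool" where
  "walsh_multiplier_sums p a f g \<longleftrightarrow> g \<in> Lp p \<and>
     (\<lambda>N. Lp_norm p ((\<Sum>n<N. (a n * walsh_coeff f n) *\<^sub>c walsh n) - g)) \<longlonglongrightarrow> 0"

definition walsh_multiplier :: "real \<Rightarrow> (nat \<Rightarrow> complex) \<Rightarrow> L0 \<Rightarrow> L0" where
  "walsh_multiplier p a f = (THE g. walsh_multiplier_sums p a f g)"

definition bounded_operator_Lp :: "real \<Rightarrow> (L0 \<Rightarrow> L0) \<Rightarrow> bool" where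
  "bounded_operator_Lp p T \<longleftrightarrow>
     (\<forall>f\<in>Lp p. T f \<in> Lp p) \<and>
     (\<forall>f\<in>Lp p. \<forall>g\<in>Lp p. T (f + g) = T f + T g) \<and>
     (\<forall>c. \<forall>f\<in>Lp p. T (c *\<^sub>c f) = c *\<^sub>c T f) \<and>
     (\<exists>C. \<forall>f\<in>Lp p. Lp_norm p (T f) \<le> C * Lp_norm p f)"

definition walsh_multiplier_bounded :: "real \<Rightarrow> (nat \<Rightarrow> complex) \<Rightarrow> bool" where
  "walsh_multiplier_bounded p a \<longleftrightarrow>
     (\<forall>f\<in>Lp p. \<exists>g. walsh_multiplier_sums p a f g) \<and>
     bounded_operator_Lp p (walsh_multiplier p a)"

definition eigenfunction :: "L0 set \<Rightarrow> (L0 \<Rightarrow> L0) \<Rightarrow> complex \<Rightarrow> L0 \<Rightarrow> bool" where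
  "eigenfunction X T c f \<longleftrightarrow> f \<in> X \<and> f \<noteq> 0 \<and> T f = c *\<^sub>c f"

definition point_spectrum :: "L0 set \<Rightarrow> (L0 \<Rightarrow> L0) \<Rightarrow> complex set" where
  "point_spectrum X T = {c. \<exists>f. eigenfunction X T c f}"

end

theory Submission
  imports Defs
begin

text \<open>
  The Walsh functions are orthonormal, so the Walsh-Fourier series of \<open>W\<^sub>n\<close> has the single
  non-zero coefficient \<open>1\<close> at \<open>n\<close>, and \<open>T\<^sub>a W\<^sub>n\<close> should collapse to \<open>a\<^sub>n W\<^sub>n\<close>.  Two points need
  an argument.

  Orthonormality (\<open>walsh_coeff_walsh\<close>): away from the dyadic rationals every Rademacher function is
  \<open>1\<close> or \<open>-1\<close>, so common factors of two Walsh functions cancel and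
  \<open>W\<^sub>m W\<^sub>n\<close> is the Walsh function whose index is the bitwise exclusive or of \<open>m\<close> and \<open>n\<close>.
  It remains to see that a Walsh function of positive index has integral zero.  If \<open>j\<close> is
  the lowest bit of the index, translation by \<open>2\<^bsup>-(j+1)\<^esup>\<close> is half a period of \<open>r\<^sub>j\<close> and a multiple of
  the period of all the finer Rademacher factors, so it reverses the sign of the product; as the
  product has period \<open>1\<close>, the translation also preserves the integral.

  The value of the operator (\<open>walsh_multiplier_walsh\<close>): the operator maps a function to the unique
  limit of its series in \<open>L\<^sup>p\<close>.  For \<open>W\<^sub>n\<close> the partial sums equal \<open>a\<^sub>n W\<^sub>n\<close> as soon as they
  include the index \<open>n\<close>, so a function \<open>g\<close> in \<open>L\<^sup>p\<close> is a limit exactly when the norm of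
  \<open>a\<^sub>n W\<^sub>n - g\<close> vanishes.  By definiteness of the norm the limit is therefore unique and
  equals \<open>a\<^sub>n W\<^sub>n\<close>.
\<close>

section \<open>Walsh functions\<close>

lemma rademacher_shift_period: "rademacher k (x + 2 * real j / 2 ^ (k + 1)) = rademacher k x"
proof -
  have "2 ^ (k + 1) * pi * (x + 2 * real j / 2 ^ (k + 1)) = 2 ^ (k + 1) * pi * x + 2 * real j * pi"
    by (simp add: field_simps)
  then show ?thesis
    unfolding rademacher_def by (simp only: sin_add cos_2npi sin_2npi) simp
qed

lemma rademacher_half_period: "rademacher k (x + 1 / 2 ^ (k + 1)) = - rademacher k x"
proof -
  have "2 ^ (k + 1) * pi * (x + 1 / 2 ^ (k + 1)) = 2 ^ (k + 1) * pi * x + pi"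
    by (simp add: field_simps)
  then show ?thesis
    unfolding rademacher_def by (simp only: sin_periodic_pi sgn_minus)
qed

text \<open>Half a period of a Rademacher function is a whole number of periods of each finer one.\<close>

lemma rademacher_finer_half_period:
  assumes "j < k"
  shows "rademacher k (x + 1 / 2 ^ (j + 1)) = rademacher k x"
proof -
  have "k = Suc j + (k - Suc j)" using assms by simp
  then have "(2::real) ^ k = 2 ^ Suc j * 2 ^ (k - Suc j)"
    by (metis power_add)
  then have "1 / 2 ^ (j + 1) = 2 * real (2 ^ (k - Suc j)) / 2 ^ (k + 1)"
    by (simp add: field_simps)
  then show ?thesis
    by (simp only: rademacher_shift_period)
qed

lemma rademacher_periodic: "rademacher k (x + 1) = rademacher k x"
  using rademacher_shift_period[of k x "2 ^ k"] by simp

lemma abs_rademacher_le_1: "\<bar>rademacher k x\<bar> \<le> 1"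
  by (simp add: rademacher_def sgn_if)

text \<open>The zeros of \<open>r\<^sub>k\<close> are multiples of \<open>2\<^bsup>-(k+1)\<^esup>\<close>; together they form a countable set.\<close>

lemma AE_rademacher_nonzero: "AE x in unit_leb. \<forall>k. rademacher k x \<noteq> 0"
proof -
  let ?D = "\<Union>k. range (\<lambda>i::int. of_int i / 2 ^ (k + 1)) :: real set"
  have "x \<in> ?D" if "rademacher k x = 0" for k x
  proof -
    have "\<exists>i::int. 2 ^ (k + 1) * pi * x = of_int i * pi"
      using that by (simp only: rademacher_def sgn_eq_0_iff sin_zero_iff_int2)
    then obtain i :: int where "2 ^ (k + 1) * pi * x = of_int i * pi" ..
    then have "x = of_int i / 2 ^ (k + 1)"
      by (simp add: field_simps)
    then show ?thesis by blast
  qed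
  moreover have "?D \<in> null_sets lebesgue"
    by (intro countable_imp_null_set_lborel[THEN null_sets_completionI]) auto
  then have "AE x in lebesgue. x \<notin> ?D"
    by (rule AE_not_in)
  then have "AE x in unit_leb. x \<notin> ?D"
    by (subst AE_restrict_space_iff) auto
  ultimately show ?thesis
    by (auto elim!: eventually_mono)
qed

lemma bit_nat_less: "bit (n::nat) k \<Longrightarrow> k < n"
  by (rule ccontr) (simp add: bit_iff_odd order_le_less_trans[OF _ less_exp])

lemma walsh_fun_0 [simp]: "walsh_fun 0 x = 1"
  by (simp add: walsh_fun_def)

text \<open>A common index set for the factors lets Walsh functions of different index be multiplied
  factor by factor.\<close>

lemma walsh_fun_conv_lessThan:
  assumes "n \<le> K"
  shows "walsh_fun n x = (\<Prod>k<K. if bit n k then rademacher k x else 1)"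
proof -
  have "{k. bit n k} = {k \<in> {..<K}. bit n k}"
    using assms by (auto dest: bit_nat_less)
  then show ?thesis
    by (simp only: walsh_fun_def prod.inter_filter finite_lessThan)
qed

text \<open>A Rademacher factor that occurs in both functions contributes \<open>r\<^sub>k\<^sup>2 = 1\<close>, so exactly the factors
  at the bits where \<open>m\<close> and \<open>n\<close> differ survive.  At a dyadic point this can fail, since a
  cancelled factor may be zero there.\<close>

lemma walsh_fun_mult:
  includes bit_operations_syntax
  assumes "\<forall>k. rademacher k x \<noteq> 0"
  shows "walsh_fun m x * walsh_fun n x = walsh_fun (m XOR n) x"
proof -
  define K where "K = m + n + (m XOR n)"
  have sq: "rademacher k x * rademacher k x = 1" for k
    using assms unfolding rademacher_def by (simp add: sgn_if split: if_splits)
  have "walsh_fun m x * walsh_fun n x = (\<Prod>k<K. (if bit m k then rademacher k x else 1) *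
      (if bit n k then rademacher k x else 1))"
    using walsh_fun_conv_lessThan[of m K x] walsh_fun_conv_lessThan[of n K x]
    by (simp add: K_def prod.distrib)
  also have "\<dots> = (\<Prod>k<K. if bit (m XOR n) k then rademacher k x else 1)"
    by (intro prod.cong) (auto simp: bit_xor_iff sq)
  also have "\<dots> = walsh_fun (m XOR n) x"
    using walsh_fun_conv_lessThan[of "m XOR n" K x] by (simp add: K_def)
  finally show ?thesis .
qed

lemma walsh_fun_periodic: "walsh_fun n (x + 1) = walsh_fun n x"
  by (simp add: walsh_fun_def rademacher_periodic)

lemma abs_walsh_fun_le_1: "\<bar>walsh_fun n x\<bar> \<le> 1"
  by (simp add: walsh_fun_def abs_prod prod_le_1 abs_rademacher_le_1)

text \<open>The witness is half a period of the coarsest Rademacher factor: it reverses the sign of that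
  factor and leaves the others fixed.  Half a period of a finer factor would shift the coarser ones
  by less than their period.\<close>

lemma walsh_fun_antiperiodic:
  assumes "n \<noteq> 0"
  obtains c where "0 \<le> c" "c \<le> 1" "\<And>x. walsh_fun n (x + c) = - walsh_fun n x"
proof -
  define j where "j = (LEAST k. bit n k)"
  have "\<exists>k. bit n k" using assms by (auto simp: bit_eq_iff)
  then have j: "bit n j" and j_min: "\<And>k. bit n k \<Longrightarrow> j \<le> k"
    unfolding j_def by (auto intro: LeastI Least_le)
  have fin: "finite {k. bit n k}"
    by (rule finite_subset[of _ "{..<n}"]) (auto dest: bit_nat_less)
  have split: "walsh_fun n x = rademacher j x * (\<Prod>k\<in>{k. bit n k} - {j}. rademacher k x)" for x
    unfolding walsh_fun_def using fin j by (intro prod.remove) auto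
  have "walsh_fun n (x + 1 / 2 ^ (j + 1)) = - walsh_fun n x" for x
  proof -
    have "(\<Prod>k\<in>{k. bit n k} - {j}. rademacher k (x + 1 / 2 ^ (j + 1))) =
        (\<Prod>k\<in>{k. bit n k} - {j}. rademacher k x)"
      using j_min by (intro prod.cong rademacher_finer_half_period) (auto simp: order_less_le)
    then show ?thesis
      by (simp only: split rademacher_half_period mult_minus_left)
  qed
  moreover have "(1::real) / 2 ^ (j + 1) \<le> 1"
    using one_le_power[of "2::real" "j + 1"] by (simp add: divide_le_eq_1)
  ultimately show thesis
    by (intro that[of "1 / 2 ^ (j + 1)"]) simp_all
qed

text \<open>Translation by \<open>c\<close> reverses the sign of the integral over a period, but an integral over a
  full period is invariant under translation.\<close>

lemma integral_periodic_antiperiodic_eq_0: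
  fixes f :: "real \<Rightarrow> real"
  assumes int: "\<And>a b. f integrable_on {a..b}"
    and per: "\<And>x. f (x + 1) = f x"
    and c: "0 \<le> c" "c \<le> 1" and anti: "\<And>x. f (x + c) = - f x"
  shows "integral {0..1} f = 0"
proof -
  have "- integral {0..1} f = integral {0..1} (\<lambda>x. f (x + c))"
    by (simp add: anti)
  also have "\<dots> = integral {c..1 + c} f"
    using integral_shift_real_ivl[of c c "1 + c" f] by simp
  (* The part of the shifted interval beyond 1 is moved back by one period. *)
  also have "\<dots> = integral {c..1} f + integral {1..1 + c} f"
    using c int by (intro Henstock_Kurzweil_Integration.integral_combine[symmetric]) auto
  also have "integral {1..1 + c} f = integral {0..c} f"
    using integral_shift_real_ivl[of 1 1 "1 + c" f] by (simp add: per)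
  also have "integral {c..1} f + integral {0..c} f = integral {0..1} f"
    using c int Henstock_Kurzweil_Integration.integral_combine[of 0 c 1 f] by simp
  finally show ?thesis by simp
qed

lemma integrable_walsh_fun: "integrable (lebesgue_on {a..b}) (walsh_fun n)"
proof -
  have "walsh_fun n \<in> borel_measurable borel"
    unfolding walsh_fun_def rademacher_def by measurable
  then have "walsh_fun n \<in> borel_measurable (lebesgue_on {a..b})"
    by (intro measurable_restrict_space1 measurable_completion) simp
  moreover have "finite_measure (lebesgue_on {a..b})"
    by (rule finite_measure_lebesgue_on) auto
  ultimately show ?thesis
    by (intro finite_measure.integrable_const_bound[where B = 1])
      (simp_all add: abs_walsh_fun_le_1)
qed

lemma integral_walsh_fun: "(LINT x|unit_leb. walsh_fun n x) = (if n = 0 then 1 else 0)"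
proof (cases "n = 0")
  case True
  then show ?thesis
    by (simp add: measure_restrict_space)
next
  case False
  then obtain c where c: "0 \<le> c" "c \<le> 1" "\<And>x. walsh_fun n (x + c) = - walsh_fun n x"
    by (rule walsh_fun_antiperiodic) blast
  have "walsh_fun n integrable_on {a..b}" for a b
    by (intro integrable_on_lebesgue_on integrable_walsh_fun) auto
  then have "integral {0..1} (walsh_fun n) = 0"
    by (rule integral_periodic_antiperiodic_eq_0[OF _ walsh_fun_periodic c])
  then show ?thesis
    using False lebesgue_integral_eq_integral[OF integrable_walsh_fun[of 0 1 n]] by simp
qed

lemma walsh_coeff_walsh:
  includes bit_operations_syntax
  shows "walsh_coeff (walsh m) n = (if m = n then 1 else 0)"
proof -
  have "walsh_coeff (walsh m) n =
      (LINT x|unit_leb. complex_of_real (walsh_fun m x) * complex_of_real (walsh_fun n x))"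
    by transfer simp
  also have "\<dots> = (LINT x|unit_leb. complex_of_real (walsh_fun (m XOR n) x))"
  proof (rule integral_cong_AE)
    show "AE x in unit_leb. complex_of_real (walsh_fun m x) * complex_of_real (walsh_fun n x) =
        complex_of_real (walsh_fun (m XOR n) x)"
      using AE_rademacher_nonzero
      by eventually_elim (simp add: walsh_fun_mult flip: of_real_mult)
  qed simp_all
  also have "\<dots> = (if m XOR n = 0 then 1 else 0)"
    by (simp add: integral_walsh_fun)
  also have "m XOR n = 0 \<longleftrightarrow> m = n"
    by (auto simp: bit_eq_iff bit_xor_iff)
  finally show ?thesis .
qed

section \<open>The spaces \<open>L\<^sup>p\<close>\<close>

lemma cscale_in_Lp: "f \<in> Lp p \<Longrightarrow> c *\<^sub>c f \<in> Lp p"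
  unfolding Lp_def mem_Collect_eq
  by transfer (simp add: norm_mult powr_mult)

text \<open>Since \<open>|u - v| \<le> 2 max(|u|, |v|)\<close>, the \<open>p\<close>-th power of the difference is dominated by
  \<open>2\<^sup>p (|u|\<^sup>p + |v|\<^sup>p)\<close>.\<close>

lemma diff_in_Lp:
  assumes "0 \<le> p" "f \<in> Lp p" "g \<in> Lp p"
  shows "f - g \<in> Lp p"
  using assms unfolding Lp_def mem_Collect_eq
proof transfer
  fix p :: real and f g :: "real \<Rightarrow> complex"
  assume p: "0 \<le> p" and "ae_rel f f" "ae_rel g g"
    and int: "integrable unit_leb (\<lambda>x. norm (f x) powr p)"
      "integrable unit_leb (\<lambda>x. norm (g x) powr p)"
  then have [measurable]: "f \<in> borel_measurable unit_leb" "g \<in> borel_measurable unit_leb"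
    by (auto simp: ae_rel_def)
  have "norm (f x - g x) powr p \<le> 2 powr p * (norm (f x) powr p + norm (g x) powr p)" for x
  proof -
    have "norm (f x - g x) powr p \<le> (2 * max (norm (f x)) (norm (g x))) powr p"
      using p norm_triangle_ineq4[of "f x" "g x"] by (intro powr_mono2) auto
    also have "\<dots> = 2 powr p * max (norm (f x)) (norm (g x)) powr p"
      by (rule powr_mult)
    also have "\<dots> \<le> 2 powr p * (norm (f x) powr p + norm (g x) powr p)"
      by (intro mult_left_mono) (auto simp: max_def)
    finally show ?thesis .
  qed
  then have "norm (norm (f x - g x) powr p) \<le>
      norm (2 powr p * (norm (f x) powr p + norm (g x) powr p))" for x
    by simp
  moreover have "integrable unit_leb (\<lambda>x. 2 powr p * (norm (f x) powr p + norm (g x) powr p))"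
    using int by simp
  ultimately show "integrable unit_leb (\<lambda>x. norm (f x - g x) powr p)"
    by (rule Bochner_Integration.integrable_bound[rotated 2, OF AE_I2]) simp_all
qed

text \<open>Membership in \<open>L\<^sup>p\<close> matters because the Bochner integral of a non-integrable function is
  \<open>0\<close> by convention, so that \<open>Lp_norm\<close> vanishes on every function outside \<open>L\<^sup>p\<close>.\<close>

lemma Lp_norm_eq_0_iff:
  assumes "f \<in> Lp p"
  shows "Lp_norm p f = 0 \<longleftrightarrow> f = 0"
  using assms unfolding Lp_def mem_Collect_eq
proof transfer
  fix p :: real and f :: "real \<Rightarrow> complex"
  assume "ae_rel f f" and int: "integrable unit_leb (\<lambda>x. norm (f x) powr p)"
  then have f: "f \<in> borel_measurable unit_leb"
    by (simp add: ae_rel_def)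
  have "(LINT x|unit_leb. norm (f x) powr p) = 0 \<longleftrightarrow> (AE x in unit_leb. norm (f x) powr p = 0)"
    by (intro integral_nonneg_eq_0_iff_AE int) simp
  then show "(LINT x|unit_leb. norm (f x) powr p) powr (1 / p) = 0 \<longleftrightarrow> ae_rel f (\<lambda>x. 0)"
    using f by (simp add: ae_rel_def)
qed

lemma walsh_in_Lp:
  assumes "0 \<le> p"
  shows "walsh n \<in> Lp p"
  using assms unfolding Lp_def mem_Collect_eq
proof transfer
  fix p :: real and n assume p: "0 \<le> p"
  have "finite_measure unit_leb"
    by (rule finite_measure_lebesgue_on) auto
  then show "integrable unit_leb (\<lambda>x. norm (complex_of_real (walsh_fun n x)) powr p)"
    using p by (intro finite_measure.integrable_const_bound[where B = 1])
      (auto intro!: AE_I2 powr_le1 simp: abs_walsh_fun_le_1)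
qed

lemma walsh_nonzero: "walsh n \<noteq> 0"
proof
  assume "walsh n = 0"
  moreover have "walsh_coeff 0 n = 0"
    by transfer simp
  ultimately show False
    using walsh_coeff_walsh[of n n] by simp
qed

section \<open>Multipliers\<close>

text \<open>Existence and uniqueness of the limit together: the distances to a candidate \<open>g\<close> are eventually
  the constant \<open>\<parallel>s - g\<parallel>\<close>, and such a sequence tends to \<open>0\<close> only if that constant is \<open>0\<close>.\<close>

lemma walsh_multiplier_sums_iff_eventually_const:
  assumes "0 \<le> p" "s \<in> Lp p"
    and "\<forall>\<^sub>F N in sequentially. (\<Sum>n<N. (a n * walsh_coeff f n) *\<^sub>c walsh n) = s"
  shows "walsh_multiplier_sums p a f g \<longleftrightarrow> g = s"
proof -
  have "(\<lambda>N. Lp_norm p ((\<Sum>n<N. (a n * walsh_coeff f n) *\<^sub>c walsh n) - g))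
      \<longlonglongrightarrow> Lp_norm p (s - g)"
    using assms(3) by (intro tendsto_eventually) (auto elim: eventually_mono)
  then have "(\<lambda>N. Lp_norm p ((\<Sum>n<N. (a n * walsh_coeff f n) *\<^sub>c walsh n) - g)) \<longlonglongrightarrow> 0
      \<longleftrightarrow> Lp_norm p (s - g) = 0"
    using LIMSEQ_unique by auto
  then show ?thesis
    using assms Lp_norm_eq_0_iff[OF diff_in_Lp[of p s g]]
    by (auto simp: walsh_multiplier_sums_def)
qed

lemma walsh_multiplier_walsh:
  assumes "0 \<le> p"
  shows "walsh_multiplier p a (walsh n) = a n *\<^sub>c walsh n"
proof -
  interpret vector_space "(*\<^sub>c)" by (rule vector_space_cscale)
  have "(\<Sum>k<N. (a k * walsh_coeff (walsh n) k) *\<^sub>c walsh k) = a n *\<^sub>c walsh n" if "n < N" for N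
  proof -
    have "(\<Sum>k<N. (a k * walsh_coeff (walsh n) k) *\<^sub>c walsh k) =
        (\<Sum>k<N. if n = k then a k *\<^sub>c walsh k else 0)"
      by (intro sum.cong) (auto simp: walsh_coeff_walsh)
    then show ?thesis
      using that by simp
  qed
  then have "\<forall>\<^sub>F N in sequentially.
      (\<Sum>k<N. (a k * walsh_coeff (walsh n) k) *\<^sub>c walsh k) = a n *\<^sub>c walsh n"
    by (rule eventually_mono[OF eventually_gt_at_top])
  then have "walsh_multiplier_sums p a (walsh n) g \<longleftrightarrow> g = a n *\<^sub>c walsh n" for g
    using assms by (intro walsh_multiplier_sums_iff_eventually_const cscale_in_Lp walsh_in_Lp)
  then show ?thesis
    by (simp add: walsh_multiplier_def)
qed

theorem proposition4p1:
  fixes p :: real and a :: "nat \<Rightarrow> complex"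
  assumes "1 < p"
    and "walsh_multiplier_bounded p a"
  shows "\<forall>n. a n \<in> point_spectrum (Lp p) (walsh_multiplier p a) \<and>
    eigenfunction (Lp p) (walsh_multiplier p a) (a n) (walsh n)"
proof
  fix n
  have "eigenfunction (Lp p) (walsh_multiplier p a) (a n) (walsh n)"
    using assms(1) by (simp add: eigenfunction_def walsh_in_Lp walsh_nonzero walsh_multiplier_walsh)
  then show "a n \<in> point_spectrum (Lp p) (walsh_multiplier p a) \<and>
      eigenfunction (Lp p) (walsh_multiplier p a) (a n) (walsh n)"
    by (auto simp: point_spectrum_def)
qed

end
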